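(* Let $\mathcal{F}$ be a $k$-uniform hypergraph with Turán density $\pi(\mathcal{F})>0$. Then $$\sigma(\mathcal{F})\le\pi(\mathcal{F})\left(\frac{\pi(\mathcal{F})}{k}+1-\frac1k\right).$$
   Context: For a $k$-uniform hypergraph $\mathcal{H}$ on $[n]=\{1,\dots,n\}$ and $E\subseteq[n]$, $d(E)$ is the number of edges of $\mathcal{H}$ containing $E$, and $\mathrm{co}_2(\mathcal{H})=\sum_{E\in\binom{[n]}{k-1}}d(E)^2$. A hypergraph is $\mathcal{F}$-free if it contains no copy of $\mathcal{F}$ (as a not necessarily induced subhypergraph). $\mathrm{ex}(n,\mathcal{F})$ is the maximum number of edges, and $\mathrm{exco}_2(n,\mathcal{F})$ the maximum of $\mathrm{co}_2(\mathcal{H})$, over all $\mathcal{F}$-free $k$-uniform hypergraphs $\mathcal{H}$ on $n$ vertices. The Turán density is $\pi(\mathcal{F})=\lim_{n\to\infty}\mathrm{ex}(n,\mathcal{F})/\binom{n}{k}$ and the codegree squared density is $\sigma(\mathcal{F})=\lim_{n\to\infty}\dfrac{\mathrm{exco}_2(n,\mathcal{F})}{\binom{n}{k-1}(n-k+1)^2}$ (both limits are known to exist). *)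

theory Defs
  imports Complex_Main "HOL-Library.Ramsey"
begin

type_synonym 'a hypergraph = "'a set \<times> 'a set set"

abbreviation verts :: "'a hypergraph \<Rightarrow> 'a set" where
  "verts H \<equiv> fst H"

abbreviation edges :: "'a hypergraph \<Rightarrow> 'a set set" where
  "edges H \<equiv> snd H"

definition uniform_hypergraph :: "nat \<Rightarrow> 'a hypergraph \<Rightarrow> bool" where
  "uniform_hypergraph k H \<longleftrightarrow> finite (verts H) \<and> edges H \<subseteq> nsets (verts H) k"

definition contains_copy :: "'b hypergraph \<Rightarrow> 'a hypergraph \<Rightarrow> bool" where
  "contains_copy H F \<longleftrightarrow>
     (\<exists>f. inj_on f (verts F) \<and> f ` verts F \<subseteq> verts H \<and> (\<forall>e\<in>edges F. f ` e \<in> edges H))"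

definition codeg :: "'a hypergraph \<Rightarrow> 'a set \<Rightarrow> nat" where
  "codeg H E = card {e \<in> edges H. E \<subseteq> e}"

definition co2 :: "nat \<Rightarrow> 'a hypergraph \<Rightarrow> nat" where
  "co2 k H = (\<Sum>E\<in>nsets (verts H) (k - 1). (codeg H E)\<^sup>2)"

definition free_hypergraphs :: "nat \<Rightarrow> nat \<Rightarrow> 'a hypergraph \<Rightarrow> nat hypergraph set" where
  "free_hypergraphs k n F =
     {H. verts H = {1..n} \<and> uniform_hypergraph k H \<and> \<not> contains_copy H F}"

(* The suprema range over finite sets of naturals, so they are maxima.  If no F-free
   hypergraph exists (F edgeless with at most n vertices), the value is Sup {} = 0. *)

definition ex_number :: "nat \<Rightarrow> nat \<Rightarrow> 'a hypergraph \<Rightarrow> nat" where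
  "ex_number k n F = (SUP H\<in>free_hypergraphs k n F. card (edges H))"

definition exco2_number :: "nat \<Rightarrow> nat \<Rightarrow> 'a hypergraph \<Rightarrow> nat" where
  "exco2_number k n F = (SUP H\<in>free_hypergraphs k n F. co2 k H)"

(* The choice operator lim gives the genuine limit only for convergent sequences;
   both sequences below do converge for a k-uniform F with k at least 1. *)

definition turan_density :: "nat \<Rightarrow> 'a hypergraph \<Rightarrow> real" where
  "turan_density k F = lim (\<lambda>n. real (ex_number k n F) / real (n choose k))"

definition codeg_sq_density :: "nat \<Rightarrow> 'a hypergraph \<Rightarrow> real" where
  "codeg_sq_density k F =
     lim (\<lambda>n. real (exco2_number k n F) / (real (n choose (k - 1)) * (real n - real k + 1)\<^sup>2))"

end

theory Submission
  imports Defs "HOL-Real_Asymp.Real_Asymp"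
begin

text \<open>
  The inequality comes from a bound in terms of the number of edges: for every \<open>k\<close>-uniform
  hypergraph with \<open>n > k\<close> vertices and \<open>e\<close> edges,
  \<open>co\<^sub>2(H) \<le> n e\<^sup>2 / (n choose k) + (k - 1) (n - k) e\<close>
  (lemma \<open>codegree_square_sum_le\<close>; de Caen's inequality for \<open>k = 2\<close> and Bey's for general \<open>k\<close>).
  Its right-hand side increases with \<open>e\<close>, so an \<open>F\<close>-free hypergraph obeys it with \<open>e\<close> replaced by
  the maximum number of edges. Dividing by \<open>(n choose (k - 1)) (n - k + 1)\<^sup>2\<close>, which is asymptotically
  \<open>k n (n choose k)\<close>, turns the two summands into \<open>\<pi>\<^sup>2 / k\<close> and \<open>\<pi> (k - 1) / k\<close>.

  Spectrally, \<open>co\<^sub>2\<close> is the quadratic form of \<open>k I + A\<close> at the indicator function of the edges, with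
  \<open>A\<close> the adjacency matrix of the Johnson graph. Constant functions have eigenvalue \<open>k (n - k + 1)\<close>
  and the next eigenvalue is \<open>(k - 1) (n - k)\<close>, attained on functions \<open>B \<mapsto> (\<Sum>x\<in>B. b x)\<close> with
  \<open>b\<close> of sum zero; the bound is what this gap gives. The proof avoids the decomposition into
  eigenspaces by induction on \<open>k\<close>. Summing \<open>co\<^sub>2\<close> over the links of all vertices gives
  \<open>(k - 1) co\<^sub>2(H)\<close>, and the bound for links reduces everything to the sum of squared vertex
  degrees. That sum is controlled by \<open>degree_variance_le\<close>, a Cauchy-Schwarz estimate against one
  function of the form just described.

  Both densities are values of the operator \<open>lim\<close>, so they can be compared only once the sequences
  are known to converge. Averaging over the deletion of a vertex shows that the maximum number of
  edges divided by \<open>n choose k\<close> does not increase with \<open>n\<close>. For \<open>co\<^sub>2\<close> the same argument applies to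
  triples of a \<open>(k - 1)\<close>-set and two edges containing it: they span at most \<open>k + 1\<close> vertices, so here
  \<open>n choose (k + 1)\<close> is the right denominator.
\<close>

section \<open>Links and double counting\<close>

lemma uniform_hypergraphD:
  assumes "uniform_hypergraph k H"
  shows "finite (verts H)" "finite (edges H)"
    and "e \<in> edges H \<Longrightarrow> e \<subseteq> verts H \<and> finite e \<and> card e = k"
  using assms finite_subset[OF _ finite_imp_finite_nsets]
  by (auto simp: uniform_hypergraph_def nsets_def)

lemma bij_betw_nsets_superset:
  assumes "S \<subseteq> V" "finite S"
  shows "bij_betw (\<lambda>B. S \<union> B) (nsets (V - S) j) {A \<in> nsets V (card S + j). S \<subseteq> A}"
proof (rule bij_betw_byWitness[where f' = "\<lambda>A. A - S"])
  show "(\<lambda>B. S \<union> B) ` nsets (V - S) j \<subseteq> {A \<in> nsets V (card S + j). S \<subseteq> A}"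
  proof clarify
    fix B assume B: "B \<in> nsets (V - S) j"
    then have "card (S \<union> B) = card S + card B"
      using assms by (intro card_Un_disjoint) (auto simp: nsets_def)
    then show "S \<union> B \<in> nsets V (card S + j) \<and> S \<subseteq> S \<union> B"
      using B assms by (auto simp: nsets_def)
  qed
  show "(\<lambda>A. A - S) ` {A \<in> nsets V (card S + j). S \<subseteq> A} \<subseteq> nsets (V - S) j"
    using assms by (auto simp: nsets_def card_Diff_subset)
qed (auto simp: nsets_def)

lemma card_nsets_superset:
  assumes "S \<subseteq> V" "finite S"
  shows "card {A \<in> nsets V (card S + j). S \<subseteq> A} = (card V - card S) choose j"
  using bij_betw_same_card[OF bij_betw_nsets_superset[OF assms, of j]] assms
  by (simp add: card_Diff_subset)

text \<open>
  Both sides add \<open>\<phi> E\<close> over the flags \<open>x \<in> E\<close>, and each \<open>E\<close> has \<open>Suc j\<close> elements.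
\<close>

lemma sum_nsets_insert:
  fixes \<phi> :: "'a set \<Rightarrow> nat"
  assumes "finite V"
  shows "(\<Sum>x\<in>V. \<Sum>B\<in>nsets (V - {x}) j. \<phi> (insert x B)) = Suc j * (\<Sum>E\<in>nsets V (Suc j). \<phi> E)"
proof -
  have "(\<Sum>B\<in>nsets (V - {x}) j. \<phi> (insert x B)) = (\<Sum>E | E \<in> nsets V (Suc j) \<and> x \<in> E. \<phi> E)"
    if "x \<in> V" for x
    using sum.reindex_bij_betw[OF bij_betw_nsets_superset[of "{x}" V j], of \<phi>] that by simp
  then have "(\<Sum>x\<in>V. \<Sum>B\<in>nsets (V - {x}) j. \<phi> (insert x B))
      = (\<Sum>x\<in>V. \<Sum>E | E \<in> nsets V (Suc j) \<and> x \<in> E. \<phi> E)"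
    by simp
  also have "\<dots> = (\<Sum>E\<in>nsets V (Suc j). \<Sum>x | x \<in> V \<and> x \<in> E. \<phi> E)"
    by (rule sum.swap_restrict) (use assms finite_imp_finite_nsets in auto)
  also have "\<dots> = (\<Sum>E\<in>nsets V (Suc j). Suc j * \<phi> E)"
  proof (rule sum.cong)
    fix E assume "E \<in> nsets V (Suc j)"
    moreover from this have "{x. x \<in> V \<and> x \<in> E} = E"
      by (auto simp: nsets_def)
    ultimately show "(\<Sum>x | x \<in> V \<and> x \<in> E. \<phi> E) = Suc j * \<phi> E"
      by (simp add: nsets_def)
  qed simp
  finally show ?thesis
    by (simp add: sum_distrib_left)
qed

definition link :: "'a hypergraph \<Rightarrow> 'a \<Rightarrow> 'a hypergraph" where
  "link H x = (verts H - {x}, (\<lambda>e. e - {x}) ` {e \<in> edges H. x \<in> e})"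

lemma uniform_hypergraph_link:
  assumes "uniform_hypergraph (Suc k) H"
  shows "uniform_hypergraph k (link H x)"
  using uniform_hypergraphD[OF assms] by (fastforce simp: uniform_hypergraph_def link_def nsets_def)

lemma inj_on_remove: "inj_on (\<lambda>e. e - {x}) {e \<in> M. x \<in> e \<and> P e}"
  by (rule inj_on_inverseI[where g = "insert x"]) auto

lemma codeg_link:
  assumes "x \<notin> B"
  shows "codeg (link H x) B = codeg H (insert x B)"
proof -
  have "{e \<in> edges (link H x). B \<subseteq> e} = (\<lambda>e. e - {x}) ` {e \<in> edges H. x \<in> e \<and> B \<subseteq> e}"
    using assms by (auto simp: link_def)
  then show ?thesis
    unfolding codeg_def by (simp add: card_image[OF inj_on_remove])
qed

lemma card_edges_link: "card (edges (link H x)) = card {e \<in> edges H. x \<in> e}"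
  using card_image[OF inj_on_remove[of x "edges H" "\<lambda>_. True"]] by (simp add: link_def)

text \<open>
  The identity that drives the induction on the uniformity: a set \<open>E\<close> of size \<open>Suc m\<close> has the same
  codegree as \<open>E - {x}\<close> in the link of \<open>x\<close>, for each of its \<open>Suc m\<close> elements \<open>x\<close>.
\<close>

lemma sum_co2_link:
  assumes "finite (verts H)"
  shows "(\<Sum>x\<in>verts H. co2 (Suc m) (link H x)) = Suc m * co2 (Suc (Suc m)) H"
proof -
  have "co2 (Suc m) (link H x) = (\<Sum>B\<in>nsets (verts H - {x}) m. (codeg H (insert x B))\<^sup>2)" for x
    unfolding co2_def
  proof (rule sum.cong)
    fix B assume "B \<in> nsets (verts H - {x}) m"
    then show "(codeg (link H x) B)\<^sup>2 = (codeg H (insert x B))\<^sup>2"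
      by (subst codeg_link) (auto simp: nsets_def)
  qed (simp add: link_def)
  then show ?thesis
    using sum_nsets_insert[OF assms, where j = m and \<phi> = "\<lambda>E. (codeg H E)\<^sup>2"] by (simp add: co2_def)
qed

text \<open>
  Double counting of the incidences \<open>x \<in> e\<close>, weighted by \<open>g x\<close>: the degree map and
  \<open>g \<mapsto> (\<lambda>e. \<Sum>x\<in>e. g x)\<close> are adjoint to each other.
\<close>

lemma sum_mult_degree:
  fixes g :: "'a \<Rightarrow> real"
  assumes "uniform_hypergraph k H"
  shows "(\<Sum>x\<in>verts H. g x * card {e \<in> edges H. x \<in> e}) = (\<Sum>e\<in>edges H. \<Sum>x\<in>e. g x)"
proof -
  have "(\<Sum>x\<in>verts H. g x * card {e \<in> edges H. x \<in> e})
      = (\<Sum>x\<in>verts H. \<Sum>e | e \<in> edges H \<and> x \<in> e. g x)"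
    by (simp add: mult.commute)
  also have "\<dots> = (\<Sum>e\<in>edges H. \<Sum>x | x \<in> verts H \<and> x \<in> e. g x)"
    by (rule sum.swap_restrict) (use uniform_hypergraphD[OF assms] in auto)
  also have "\<dots> = (\<Sum>e\<in>edges H. \<Sum>x\<in>e. g x)"
    by (intro sum.cong refl) (use uniform_hypergraphD[OF assms] in auto)
  finally show ?thesis .
qed

section \<open>A spectral gap bound for sums of squared codegrees\<close>

text \<open>
  Expanding the square, a pair \<open>(x, y)\<close> is weighted by the number of sets containing both. This
  number depends only on whether \<open>x = y\<close>: the incidence matrix composed with its transpose is
  \<open>(n choose Suc m) I + (n choose m) J\<close>, with \<open>J\<close> the all-ones matrix, which kills vectors of sum zero.
\<close>

lemma sum_nsets_sum_square:
  fixes b :: "'a \<Rightarrow> real"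
  assumes "finite V" and b0: "(\<Sum>x\<in>V. b x) = 0" and "card V = Suc (Suc n)"
  shows "(\<Sum>A\<in>nsets V (Suc (Suc m)). (\<Sum>x\<in>A. b x)\<^sup>2) = (n choose Suc m) * (\<Sum>x\<in>V. (b x)\<^sup>2)"
proof -
  let ?W = "nsets V (Suc (Suc m))"
  have fin: "finite ?W"
    using assms finite_imp_finite_nsets by blast
  have "(\<Sum>A\<in>?W. (\<Sum>x\<in>A. b x)\<^sup>2) = (\<Sum>A\<in>?W. \<Sum>p | p \<in> V \<times> V \<and> {fst p, snd p} \<subseteq> A. b (fst p) * b (snd p))"
  proof (rule sum.cong)
    fix A assume "A \<in> ?W"
    then have "{p. p \<in> V \<times> V \<and> {fst p, snd p} \<subseteq> A} = A \<times> A"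
      by (auto simp: nsets_def)
    then show "(\<Sum>x\<in>A. b x)\<^sup>2 = (\<Sum>p | p \<in> V \<times> V \<and> {fst p, snd p} \<subseteq> A. b (fst p) * b (snd p))"
      by (simp add: power2_eq_square sum_product sum.cartesian_product split_def)
  qed simp
  also have "\<dots> = (\<Sum>p\<in>V \<times> V. \<Sum>A | A \<in> ?W \<and> {fst p, snd p} \<subseteq> A. b (fst p) * b (snd p))"
    by (rule sum.swap_restrict[symmetric]) (use assms fin in auto)
  also have "\<dots> = (\<Sum>p\<in>V \<times> V. card {A \<in> ?W. {fst p, snd p} \<subseteq> A} * (b (fst p) * b (snd p)))"
    by simp
  also have "\<dots> = (\<Sum>p\<in>V \<times> V. ((n choose m) + (if fst p = snd p then n choose Suc m else 0)) * (b (fst p) * b (snd p)))"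
  proof (rule sum.cong[OF refl])
    fix p assume p: "p \<in> V \<times> V"
    have "card {A \<in> ?W. {fst p, snd p} \<subseteq> A} = (n choose m) + (if fst p = snd p then n choose Suc m else 0)"
    proof (cases "fst p = snd p")
      case True
      then show ?thesis
        using card_nsets_superset[of "{fst p}" V "Suc m"] p assms by auto
    next
      case False
      then show ?thesis
        using card_nsets_superset[of "{fst p, snd p}" V m] p assms by auto
    qed
    then show "card {A \<in> ?W. {fst p, snd p} \<subseteq> A} * (b (fst p) * b (snd p))
      = ((n choose m) + (if fst p = snd p then n choose Suc m else 0)) * (b (fst p) * b (snd p))"
      by (simp only:)
  qed
  also have "\<dots> = (\<Sum>x\<in>V. \<Sum>y\<in>V. (n choose m) * (b x * b y) + (if x = y then (n choose Suc m) * (b x)\<^sup>2 else 0))"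
    by (simp add: sum.cartesian_product split_def)
       (intro sum.cong refl, auto simp: power2_eq_square algebra_simps)
  also have "\<dots> = (n choose m) * (\<Sum>x\<in>V. b x)\<^sup>2 + (n choose Suc m) * (\<Sum>x\<in>V. (b x)\<^sup>2)"
    using assms(1)
    by (simp add: sum.distrib power2_eq_square sum_product flip: sum_distrib_left)
  finally show ?thesis
    using b0 by simp
qed

text \<open>
  With \<open>k = m + 2\<close>, let \<open>b\<close> be the deviation of the degrees from their mean, with sum of squares \<open>S\<close>.
  By adjointness the sums \<open>\<Sum>x\<in>A. b x\<close> add up to \<open>S\<close> over the edges and to 0 over all \<open>k\<close>-sets, while
  their squares add up to \<open>c S\<close> with \<open>c = n choose Suc m\<close>. Writing \<open>C\<close> for the number of all \<open>k\<close>-sets,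
  Cauchy-Schwarz against the centred indicator function of the edges, whose squared norm is
  \<open>e - e\<^sup>2 / C\<close>, yields \<open>S\<^sup>2 \<le> c S (e - e\<^sup>2 / C)\<close>. Centring the indicator function matters: without
  the term \<open>- e\<^sup>2 / C\<close> the induction would lose a constant factor in the leading term.
\<close>

lemma degree_variance_le:
  fixes H :: "'a hypergraph"
  assumes H: "uniform_hypergraph (Suc (Suc m)) H" and n: "card (verts H) = Suc (Suc n)" and "m < n"
  defines "e \<equiv> real (card (edges H))"
  shows "(\<Sum>x\<in>verts H. (real (card {A \<in> edges H. x \<in> A}))\<^sup>2)
    \<le> (real (Suc (Suc m)) * e)\<^sup>2 / real (Suc (Suc n))
      + (n choose Suc m) * (e - e\<^sup>2 / (Suc (Suc n) choose Suc (Suc m)))"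
proof -
  define V where "V = verts H"
  define M where "M = edges H"
  define k where "k = Suc (Suc m)"
  define N where "N = real (Suc (Suc n))"
  define C where "C = real (Suc (Suc n) choose k)"
  define c where "c = real (n choose Suc m)"
  define d where "d x = real (card {A \<in> M. x \<in> A})" for x
  define b where "b x = d x - k * e / N" for x
  have [simp]: "finite V" "finite M" "finite (nsets V k)" "card V = Suc (Suc n)"
    using uniform_hypergraphD[OF H] n by (auto simp: V_def M_def finite_imp_finite_nsets)
  have N: "N > 0" and C: "C > 0" and c: "c > 0"
    using \<open>m < n\<close> by (auto simp: N_def C_def c_def k_def simp del: binomial_Suc_Suc)
  have M: "M \<subseteq> nsets V k"
    using H by (simp add: uniform_hypergraph_def M_def V_def k_def)
  have swap: "(\<Sum>x\<in>V. g x * d x) = (\<Sum>A\<in>M. \<Sum>x\<in>A. g x)" for g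
    unfolding V_def d_def M_def by (rule sum_mult_degree[OF H])
  have "(\<Sum>A\<in>M. \<Sum>x\<in>A. 1) = (\<Sum>A\<in>M. real k)"
    using M by (intro sum.cong) (auto simp: nsets_def)
  then have sum_d: "(\<Sum>x\<in>V. d x) = k * e"
    using swap[of "\<lambda>_. 1"] by (simp add: e_def M_def)
  have cardV: "real (card V) = N"
    by (simp add: N_def)
  have b0: "(\<Sum>x\<in>V. b x) = 0"
    unfolding b_def sum_subtractf sum_d sum_constant cardV using N by simp
  define S where "S = (\<Sum>x\<in>V. (b x)\<^sup>2)"
  have S_edges: "(\<Sum>A\<in>M. \<Sum>x\<in>A. b x) = S"
  proof -
    have "(\<Sum>A\<in>M. \<Sum>x\<in>A. b x) = (\<Sum>x\<in>V. b x * (b x + k * e / N))"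
      unfolding swap[symmetric] b_def by simp
    also have "\<dots> = S + (k * e / N) * (\<Sum>x\<in>V. b x)"
      by (simp add: S_def algebra_simps power2_eq_square sum.distrib sum_distrib_left sum_divide_distrib)
    finally show ?thesis using b0 by simp
  qed
  have S_d: "S = (\<Sum>x\<in>V. (d x)\<^sup>2) - (k * e)\<^sup>2 / N"
  proof -
    have "S = (\<Sum>x\<in>V. (d x)\<^sup>2 - 2 * (k * e / N) * d x + (k * e / N)\<^sup>2)"
      unfolding S_def b_def by (simp add: power2_diff algebra_simps)
    also have "\<dots> = (\<Sum>x\<in>V. (d x)\<^sup>2) - 2 * (k * e / N) * (k * e) + N * (k * e / N)\<^sup>2"
      by (simp only: sum.distrib sum_subtractf sum_distrib_left[symmetric] sum_d sum_constant cardV)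
    also have "\<dots> = (\<Sum>x\<in>V. (d x)\<^sup>2) - (k * e)\<^sup>2 / N"
      using N by (simp add: field_simps power2_eq_square)
    finally show ?thesis .
  qed
  have all: "(\<Sum>A\<in>nsets V k. \<Sum>x\<in>A. b x) = 0"
  proof -
    have card: "card {A \<in> nsets V k. x \<in> A} = Suc n choose Suc m" if "x \<in> V" for x
      using card_nsets_superset[of "{x}" V "Suc m"] that by (simp add: k_def)
    have "uniform_hypergraph k (V, nsets V k)"
      by (simp add: uniform_hypergraph_def)
    from sum_mult_degree[OF this, of b] have "(\<Sum>A\<in>nsets V k. \<Sum>x\<in>A. b x) = (\<Sum>x\<in>V. b x * (Suc n choose Suc m))"
      by (simp add: card)
    then show ?thesis using b0 by (simp add: sum_distrib_right[symmetric])
  qed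
  have sq: "(\<Sum>A\<in>nsets V k. (\<Sum>x\<in>A. b x)\<^sup>2) = c * S"
    unfolding c_def S_def k_def by (rule sum_nsets_sum_square) (use b0 in auto)
  \<comment> \<open>Cauchy-Schwarz as one nonnegative square: \<open>c\<close> is the scalar for which the two vectors coincide
     in the case of equality, so that the expansion factors through \<open>c\<close>.\<close>
  define p where "p = e / C"
  define f where "f A = (if A \<in> M then 1 else 0::real)" for A
  have sum_f: "(\<Sum>A\<in>nsets V k. f A * g A) = (\<Sum>A\<in>M. g A)" for g :: "'a set \<Rightarrow> real"
  proof -
    have "(\<Sum>A\<in>nsets V k. f A * g A) = (\<Sum>A\<in>nsets V k. if A \<in> M then g A else 0)"
      by (rule sum.cong) (auto simp: f_def)
    also have "\<dots> = (\<Sum>A\<in>M. g A)"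
      using M by (simp add: sum.inter_restrict[symmetric] Int_absorb1)
    finally show ?thesis .
  qed
  have "0 \<le> (\<Sum>A\<in>nsets V k. ((\<Sum>x\<in>A. b x) - c * (f A - p))\<^sup>2)"
    by (simp add: sum_nonneg)
  also have "\<dots> = (\<Sum>A\<in>nsets V k. (\<Sum>x\<in>A. b x)\<^sup>2 - 2 * c * (f A * (\<Sum>x\<in>A. b x))
      + 2 * c * p * (\<Sum>x\<in>A. b x) + c\<^sup>2 * (1 - 2 * p) * (f A * 1) + c\<^sup>2 * p\<^sup>2)"
    by (rule sum.cong) (auto simp: f_def power2_eq_square algebra_simps)
  also have "\<dots> = c * S - 2 * c * S + c\<^sup>2 * (1 - 2 * p) * e + C * (c\<^sup>2 * p\<^sup>2)"
    unfolding sum.distrib sum_subtractf sum_distrib_left[symmetric] sum_f sq all S_edges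
    by (simp add: e_def M_def C_def k_def)
  also have "\<dots> = c * (c * (e - e\<^sup>2 / C) - S)"
    using C by (simp add: p_def field_simps power2_eq_square)
  finally have "S \<le> c * (e - e\<^sup>2 / C)"
    using c by (simp add: zero_le_mult_iff)
  then show ?thesis
    unfolding S_d by (simp add: d_def c_def C_def N_def V_def M_def k_def)
qed

text \<open>
  For \<open>k = 1\<close> this is an equality. In the step both estimates, the bound for the links and the one for
  the degree variance, are equalities on the second eigenspace of the Johnson graph, so nothing is lost
  and the constants of the spectral gap survive the induction. The assumption that there are more
  vertices than the uniformity is inherited by links, and it makes the binomial coefficient in
  \<open>degree_variance_le\<close> positive.
\<close>

lemma codegree_square_sum_le:
  fixes H :: "'a hypergraph"
  assumes "uniform_hypergraph (Suc m) H" and "Suc m < card (verts H)"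
  shows "real (co2 (Suc m) H)
    \<le> real (card (verts H)) * (real (card (edges H)))\<^sup>2 / (card (verts H) choose Suc m)
      + real m * (real (card (verts H)) - real (Suc m)) * card (edges H)"
  using assms
proof (induction m arbitrary: H)
  case 0
  have "nsets (verts H) 0 = {{}}"
    by (auto simp: nsets_def)
  then have "co2 (Suc 0) H = (card (edges H))\<^sup>2"
    by (simp add: co2_def codeg_def)
  then show ?case
    using 0 by simp
next
  case (Suc m)
  obtain n where n: "card (verts H) = Suc (Suc n)" "m < n"
    using Suc.prems(2) by (metis Suc_lessE Suc_less_eq)
  define e where "e = real (card (edges H))"
  define k where "k = real (Suc (Suc m))"
  define N where "N = real (Suc (Suc n))"
  define C where "C = real (Suc (Suc n) choose Suc (Suc m))"
  define D where "D = real (Suc n choose Suc m)"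
  define d where "d x = real (card {A \<in> edges H. x \<in> A})" for x
  have fin: "finite (verts H)"
    using uniform_hypergraphD[OF Suc.prems(1)] by simp
  have k: "k > 1" and N: "N > 1" and C: "C > 0" and D: "D > 0"
    using n by (auto simp: k_def C_def D_def N_def simp del: binomial_Suc_Suc)
  have ND: "N * D = k * C"
    using Suc_times_binomial_eq[of "Suc n" "Suc m"]
    by (metis (mono_tags) C_def D_def N_def k_def mult.commute of_nat_mult)
  have sum_d: "(\<Sum>x\<in>verts H. d x) = k * e"
  proof -
    have "(\<Sum>x\<in>verts H. d x) = (\<Sum>A\<in>edges H. \<Sum>x\<in>A. 1)"
      using sum_mult_degree[OF Suc.prems(1), of "\<lambda>_. 1"] by (simp add: d_def)
    also have "\<dots> = (\<Sum>A\<in>edges H. k)"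
      using uniform_hypergraphD(3)[OF Suc.prems(1)] by (intro sum.cong) (auto simp: k_def)
    finally show ?thesis by (simp add: e_def)
  qed
  have absorb: "(N - 1) * (n choose Suc m) = (N - k) * D"
  proof -
    have "real (Suc n) * (n choose m) = (Suc m) * D"
      unfolding D_def using Suc_times_binomial_eq[of n m] by (metis mult.commute of_nat_mult)
    moreover have "D = (n choose m) + (n choose Suc m)"
      by (simp add: D_def)
    ultimately show ?thesis by (simp add: N_def k_def algebra_simps)
  qed
  have "real (Suc m) * co2 (Suc (Suc m)) H = (\<Sum>x\<in>verts H. real (co2 (Suc m) (link H x)))"
    using sum_co2_link[OF fin, of m] by (metis of_nat_mult of_nat_sum)
  also have "\<dots> \<le> (\<Sum>x\<in>verts H. (N - 1) / D * (d x)\<^sup>2 + m * (N - k) * d x)"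
  proof (rule sum_mono)
    fix x assume x: "x \<in> verts H"
    have "card (verts (link H x)) = Suc n"
      using x n fin by (simp add: link_def)
    with Suc.IH[OF uniform_hypergraph_link[OF Suc.prems(1)], of x] n
    show "real (co2 (Suc m) (link H x)) \<le> (N - 1) / D * (d x)\<^sup>2 + m * (N - k) * d x"
      by (simp add: card_edges_link N_def D_def d_def k_def)
  qed
  also have "\<dots> = (N - 1) / D * (\<Sum>x\<in>verts H. (d x)\<^sup>2) + m * (N - k) * (k * e)"
    by (simp only: sum.distrib sum_distrib_left[symmetric] sum_d)
  also have "\<dots> \<le> (N - 1) / D * ((k * e)\<^sup>2 / N + (n choose Suc m) * (e - e\<^sup>2 / C)) + m * (N - k) * (k * e)"
    using degree_variance_le[OF Suc.prems(1) n] N D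
    by (intro add_right_mono mult_left_mono) (simp_all add: d_def k_def e_def N_def C_def)
  also have "\<dots> = (N - 1) * (k * e)\<^sup>2 / (N * D) + ((N - 1) * (n choose Suc m)) / D * (e - e\<^sup>2 / C) + m * (N - k) * (k * e)"
    by (simp add: algebra_simps add_divide_distrib diff_divide_distrib)
  also have "\<dots> = (N - 1) * k * (e\<^sup>2 / C) + (N - k) * (e - e\<^sup>2 / C) + m * (N - k) * (k * e)"
    unfolding ND absorb using C D k by (simp add: field_simps power2_eq_square)
  also have "\<dots> = real (Suc m) * (N * e\<^sup>2 / C + real (Suc m) * (N - k) * e)"
    by (simp add: k_def algebra_simps power2_eq_square add_divide_distrib)
  finally have "co2 (Suc (Suc m)) H \<le> N * e\<^sup>2 / C + real (Suc m) * (N - k) * e"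
    by (simp only: mult_le_cancel_left_pos of_nat_0_less_iff zero_less_Suc)
  then show ?case
    by (simp add: n N_def C_def k_def e_def)
qed


section \<open>Averaging over vertex deletions\<close>

definition delete_vertex :: "'a hypergraph \<Rightarrow> 'a \<Rightarrow> 'a hypergraph" where
  "delete_vertex H v = (verts H - {v}, {e \<in> edges H. v \<notin> e})"

lemma delete_vertex_free:
  assumes "uniform_hypergraph k H" "\<not> contains_copy H F"
  shows "uniform_hypergraph k (delete_vertex H v)" "\<not> contains_copy (delete_vertex H v) F"
  using assms by (auto simp: uniform_hypergraph_def delete_vertex_def nsets_def contains_copy_def) blast+

text \<open>
  Deleting a random vertex destroys a configuration \<open>t\<close> with probability at most \<open>j / card V\<close>. Both
  extremal numbers are handled by this count, with edges and with pairs of edges through a common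
  \<open>(k - 1)\<close>-set as configurations.
\<close>

lemma sum_avoiding_le:
  assumes "finite V" "finite T"
    and s: "\<And>t. t \<in> T \<Longrightarrow> s t \<subseteq> V \<and> card (s t) \<le> j"
    and u: "\<And>v. v \<in> V \<Longrightarrow> card {t \<in> T. v \<notin> s t} \<le> u"
  shows "(card V - j) * card T \<le> card V * u"
proof -
  have "(card V - j) * card T = (\<Sum>t\<in>T. card V - j)"
    by simp
  also have "\<dots> \<le> (\<Sum>t\<in>T. card (V - s t))"
  proof (rule sum_mono)
    fix t assume "t \<in> T"
    with s[OF this] assms(1) diff_card_le_card_Diff[of "s t" V] show "card V - j \<le> card (V - s t)"
      by (auto dest: finite_subset)
  qed
  also have "\<dots> = (\<Sum>v\<in>V. card {t \<in> T. v \<notin> s t})"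
    by (rule sum_multicount_gen[symmetric]) (use assms in \<open>auto simp: set_diff_eq\<close>)
  also have "\<dots> \<le> card V * u"
    using sum_mono[of V "\<lambda>v. card {t \<in> T. v \<notin> s t}" "\<lambda>_. u"] u by simp
  finally show ?thesis .
qed

text \<open>
  The squared codegrees written as a cardinality, which makes \<open>co\<^sub>2\<close> accessible to the averaging
  argument.
\<close>

definition codegree_triples :: "nat \<Rightarrow> 'a hypergraph \<Rightarrow> ('a set \<times> 'a set \<times> 'a set) set" where
  "codegree_triples k H =
     (SIGMA E:nsets (verts H) (k - 1). {e \<in> edges H. E \<subseteq> e} \<times> {e \<in> edges H. E \<subseteq> e})"

lemma codegree_triples:
  assumes "uniform_hypergraph k H"
  shows "finite (codegree_triples k H)" "co2 k H = card (codegree_triples k H)"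
  using uniform_hypergraphD[OF assms]
  by (auto simp: codegree_triples_def co2_def codeg_def card_cartesian_product power2_eq_square
      finite_imp_finite_nsets)

lemma co2_delete_vertex:
  assumes "uniform_hypergraph k H"
  shows "co2 k (delete_vertex H v)
    = card {t \<in> codegree_triples k H. v \<notin> (case t of (E, e, f) \<Rightarrow> e \<union> f)}"
proof -
  have "uniform_hypergraph k (delete_vertex H v)"
    using assms by (auto simp: uniform_hypergraph_def delete_vertex_def nsets_def)
  moreover have "codegree_triples k (delete_vertex H v)
      = {t \<in> codegree_triples k H. v \<notin> (case t of (E, e, f) \<Rightarrow> e \<union> f)}"
    by (auto simp: codegree_triples_def delete_vertex_def nsets_def)
  ultimately show ?thesis
    by (simp add: codegree_triples(2))
qed

text \<open>
  The two edges share at least the \<open>k - 1\<close> vertices of \<open>E\<close>.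
\<close>

lemma card_edge_union_le:
  assumes "uniform_hypergraph k H" "k \<ge> 1" "(E, e, f) \<in> codegree_triples k H"
  shows "e \<union> f \<subseteq> verts H \<and> card (e \<union> f) \<le> Suc k"
proof -
  have E: "card E = k - 1" "E \<subseteq> e \<inter> f" and "e \<in> edges H" "f \<in> edges H"
    using assms(3) by (auto simp: codegree_triples_def nsets_def)
  note ef = uniform_hypergraphD(3)[OF assms(1) this(3)] uniform_hypergraphD(3)[OF assms(1) this(4)]
  have "k - 1 \<le> card (e \<inter> f)"
    using E ef card_mono[of "e \<inter> f" E] by auto
  with card_Un_Int[of e f] ef assms(2) show ?thesis
    by auto
qed

section \<open>Relabelling and extremal numbers\<close>

definition map_hypergraph :: "('a \<Rightarrow> 'b) \<Rightarrow> 'a hypergraph \<Rightarrow> 'b hypergraph" where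
  "map_hypergraph g H = (g ` verts H, (`) g ` edges H)"

lemma map_hypergraph:
  assumes H: "uniform_hypergraph k H" and g: "inj_on g (verts H)"
  shows "uniform_hypergraph k (map_hypergraph g H)"
    and "card (edges (map_hypergraph g H)) = card (edges H)"
    and "co2 k (map_hypergraph g H) = co2 k H"
    and "contains_copy (map_hypergraph g H) F \<Longrightarrow> contains_copy H F"
proof -
  note HD = uniform_hypergraphD[OF H]
  have sub: "edges H \<subseteq> Pow (verts H)"
    using HD(3) by auto
  have inj: "inj_on ((`) g) (Pow (verts H))"
    using g by (rule inj_on_image_Pow)
  show unif: "uniform_hypergraph k (map_hypergraph g H)"
    using HD g by (auto simp: uniform_hypergraph_def map_hypergraph_def nsets_def
        card_image inj_on_subset)
  show "card (edges (map_hypergraph g H)) = card (edges H)"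
    using card_image[OF inj_on_subset[OF inj sub]] by (simp add: map_hypergraph_def)
  have codeg: "codeg (map_hypergraph g H) (g ` E) = codeg H E" if "E \<subseteq> verts H" for E
  proof -
    have "E \<subseteq> e" if "g ` E \<subseteq> g ` e" "e \<in> edges H" for e
    proof
      fix x assume "x \<in> E"
      with that \<open>E \<subseteq> verts H\<close> sub show "x \<in> e"
        using inj_on_image_mem_iff[OF g, of x e] by auto
    qed
    then have "{e \<in> edges (map_hypergraph g H). g ` E \<subseteq> e} = (`) g ` {e \<in> edges H. E \<subseteq> e}"
      by (auto simp: map_hypergraph_def)
    moreover have "{e \<in> edges H. E \<subseteq> e} \<subseteq> Pow (verts H)"
      using sub by auto
    ultimately show ?thesis
      unfolding codeg_def using card_image[OF inj_on_subset[OF inj]] by metis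
  qed
  have "bij_betw ((`) g) (nsets (verts H) (k - 1)) (nsets (g ` verts H) (k - 1))"
    by (rule bij_betw_nsets) (use g in \<open>simp add: bij_betw_def\<close>)
  from sum.reindex_bij_betw[OF this, of "\<lambda>E. (codeg (map_hypergraph g H) E)\<^sup>2"]
  have "co2 k (map_hypergraph g H)
      = (\<Sum>E\<in>nsets (verts H) (k - 1). (codeg (map_hypergraph g H) (g ` E))\<^sup>2)"
    by (simp add: co2_def map_hypergraph_def)
  also have "\<dots> = co2 k H"
    unfolding co2_def by (rule sum.cong) (auto simp: codeg nsets_def)
  finally show "co2 k (map_hypergraph g H) = co2 k H" .
  show "contains_copy H F" if copy: "contains_copy (map_hypergraph g H) F"
  proof -
    obtain f where f: "inj_on f (verts F)" "f ` verts F \<subseteq> g ` verts H"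
      and fe: "\<forall>e\<in>edges F. f ` e \<in> (`) g ` edges H"
      using copy unfolding contains_copy_def map_hypergraph_def fst_conv snd_conv
      by (elim exE conjE)
    define h where "h = inv_into (verts H) g \<circ> f"
    have "inj_on h (verts F)"
      unfolding h_def using f by (intro comp_inj_on) (auto intro: inj_on_subset[OF inj_on_inv_into])
    moreover have "h ` verts F \<subseteq> verts H"
      using f(2) by (auto simp: h_def intro!: inv_into_into)
    moreover have "h ` e \<in> edges H" if e: "e \<in> edges F" for e
    proof -
      obtain e' where e': "e' \<in> edges H" "f ` e = g ` e'"
        using bspec[OF fe e] by (rule imageE)
      then have "h ` e = inv_into (verts H) g ` g ` e'"
        by (simp only: h_def image_comp[symmetric])
      also have "\<dots> = e'"
        using g sub e' by (intro inv_into_image_cancel) auto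
      finally show ?thesis using e' by simp
    qed
    ultimately show ?thesis
      by (auto simp: contains_copy_def)
  qed
qed

text \<open>
  Finiteness makes the suprema in the extremal numbers attained maxima.
\<close>

lemma finite_free_hypergraphs: "finite (free_hypergraphs k n F)"
proof (rule finite_subset)
  show "free_hypergraphs k n F \<subseteq> Pair {1..n} ` Pow (Pow {1..n})"
    by (fastforce simp: free_hypergraphs_def uniform_hypergraph_def nsets_def)
qed auto

text \<open>
  The extremal numbers quantify over hypergraphs on \<open>{1..n}\<close> only. Relabelling extends the bound to
  any vertex set of that size, in particular to \<open>{1..n}\<close> with one vertex deleted.
\<close>

lemma free_hypergraph_le_extremal:
  fixes H :: "'b hypergraph"
  assumes "uniform_hypergraph k H" "\<not> contains_copy H F"
  shows "card (edges H) \<le> ex_number k (card (verts H)) F"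
    and "co2 k H \<le> exco2_number k (card (verts H)) F"
proof -
  obtain g where g: "bij_betw g (verts H) {1..card (verts H)}"
    using finite_same_card_bij[OF uniform_hypergraphD(1)[OF assms(1)], of "{1..card (verts H)}"] by auto
  then have inj: "inj_on g (verts H)" and img: "g ` verts H = {1..card (verts H)}"
    by (auto simp: bij_betw_def)
  note map = map_hypergraph[OF assms(1) inj]
  have mem: "map_hypergraph g H \<in> free_hypergraphs k (card (verts H)) F"
    using map(1) map(4)[where F = F] assms(2) img
    unfolding free_hypergraphs_def map_hypergraph_def by auto
  have "card (edges (map_hypergraph g H)) \<le> ex_number k (card (verts H)) F"
    unfolding ex_number_def by (rule cSUP_upper[OF mem]) (simp add: finite_free_hypergraphs)
  then show "card (edges H) \<le> ex_number k (card (verts H)) F"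
    by (simp add: map)
  have "co2 k (map_hypergraph g H) \<le> exco2_number k (card (verts H)) F"
    unfolding exco2_number_def by (rule cSUP_upper[OF mem]) (simp add: finite_free_hypergraphs)
  then show "co2 k H \<le> exco2_number k (card (verts H)) F"
    by (simp add: map)
qed

lemma SUP_nat_attained:
  fixes f :: "'b \<Rightarrow> nat"
  assumes "finite A" "A \<noteq> {}"
  obtains a where "a \<in> A" "(SUP a\<in>A. f a) = f a"
proof -
  have "(SUP a\<in>A. f a) = Max (f ` A)"
    using assms by (simp add: Sup_nat_def)
  also have "\<dots> \<in> f ` A"
    using assms by (intro Max_in) auto
  finally show thesis
    using that by auto
qed

section \<open>Convergence of the density sequences\<close>

lemma ex_number_step: "(Suc n - k) * ex_number k (Suc n) F \<le> Suc n * ex_number k n F"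
proof (cases "free_hypergraphs k (Suc n) F = {}")
  case True
  then show ?thesis by (simp add: ex_number_def Sup_nat_def)
next
  case False
  then obtain H where "H \<in> free_hypergraphs k (Suc n) F"
    and eq: "ex_number k (Suc n) F = card (edges H)"
    using SUP_nat_attained[OF finite_free_hypergraphs] unfolding ex_number_def by metis
  then have V: "verts H = {1..Suc n}" and H: "uniform_hypergraph k H" "\<not> contains_copy H F"
    by (auto simp: free_hypergraphs_def)
  have "(card (verts H) - k) * card (edges H) \<le> card (verts H) * ex_number k n F"
  proof (rule sum_avoiding_le[where s = id])
    fix v assume "v \<in> verts H"
    then have "card (verts (delete_vertex H v)) = n"
      by (simp add: V delete_vertex_def)
    with free_hypergraph_le_extremal(1)[OF delete_vertex_free[OF H], of v]
    show "card {e \<in> edges H. v \<notin> id e} \<le> ex_number k n F"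
      by (simp add: delete_vertex_def)
  qed (use uniform_hypergraphD[OF H(1)] in auto)
  then show ?thesis by (simp add: V eq)
qed

lemma exco2_number_step:
  assumes "k \<ge> 1"
  shows "(Suc n - Suc k) * exco2_number k (Suc n) F \<le> Suc n * exco2_number k n F"
proof (cases "free_hypergraphs k (Suc n) F = {}")
  case True
  then show ?thesis by (simp add: exco2_number_def Sup_nat_def)
next
  case False
  then obtain H where "H \<in> free_hypergraphs k (Suc n) F"
    and eq: "exco2_number k (Suc n) F = co2 k H"
    using SUP_nat_attained[OF finite_free_hypergraphs] unfolding exco2_number_def by metis
  then have V: "verts H = {1..Suc n}" and H: "uniform_hypergraph k H" "\<not> contains_copy H F"
    by (auto simp: free_hypergraphs_def)
  have "(card (verts H) - Suc k) * card (codegree_triples k H) \<le> card (verts H) * exco2_number k n F"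
  proof (rule sum_avoiding_le[where s = "\<lambda>(E, e, f). e \<union> f"])
    fix v assume "v \<in> verts H"
    then have "card (verts (delete_vertex H v)) = n"
      by (simp add: V delete_vertex_def)
    with free_hypergraph_le_extremal(2)[OF delete_vertex_free[OF H], of v]
    show "card {t \<in> codegree_triples k H. v \<notin> (case t of (E, e, f) \<Rightarrow> e \<union> f)} \<le> exco2_number k n F"
      by (simp only: co2_delete_vertex[OF H(1)])
  next
    fix t assume t: "t \<in> codegree_triples k H"
    obtain E e f where "t = (E, e, f)"
      by (cases t)
    with t show "(case t of (E, e, f) \<Rightarrow> e \<union> f) \<subseteq> verts H \<and> card (case t of (E, e, f) \<Rightarrow> e \<union> f) \<le> Suc k"
      using card_edge_union_le[OF H(1) assms, of E e f] by simp
  qed (rule uniform_hypergraphD(1)[OF H(1)], rule codegree_triples(1)[OF H(1)])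
  then show ?thesis by (simp add: V eq codegree_triples(2)[OF H(1)])
qed

text \<open>
  Since \<open>(Suc n - j) (Suc n choose j) = Suc n (n choose j)\<close>, the hypothesis says that the ratio does not
  increase from \<open>n\<close> to \<open>Suc n\<close>. The indices below \<open>j\<close> must be skipped: there the ratio is 0 by division
  by zero.
\<close>

lemma convergent_binomial_ratio:
  fixes u :: "nat \<Rightarrow> nat"
  assumes "\<And>n. (Suc n - j) * u (Suc n) \<le> Suc n * u n"
  shows "convergent (\<lambda>n. real (u n) / real (n choose j))"
proof -
  let ?X = "\<lambda>n. real (u n) / real (n choose j)"
  have "decseq (\<lambda>n. ?X (n + j))"
  proof (rule decseq_SucI)
    fix n
    define N where "N = n + j"
    have pos: "0 < real (N choose j)" "0 < real (Suc N choose j)" "0 < real (Suc N - j)"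
      by (auto simp: N_def)
    have "(Suc N - j) * (Suc N choose j) = Suc N * (N choose j)"
      using binomial_absorb_comp[of "Suc N" j] by simp
    then have b: "real (Suc N - j) * (Suc N choose j) = real (Suc N) * (N choose j)"
      by (metis of_nat_mult)
    have a: "real (Suc N - j) * u (Suc N) \<le> real (Suc N) * u N"
      using assms[of N] by (metis of_nat_mono of_nat_mult)
    have "?X (Suc N) = (real (Suc N - j) * u (Suc N)) / (real (Suc N - j) * (Suc N choose j))"
      using pos by simp
    also have "\<dots> \<le> (real (Suc N) * u N) / (real (Suc N) * (N choose j))"
      unfolding b using a pos by (intro divide_right_mono) auto
    also have "\<dots> = ?X N"
      by (simp del: of_nat_Suc)
    finally show "?X (Suc n + j) \<le> ?X (n + j)"
      by (simp add: N_def)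
  qed
  then obtain L where "(\<lambda>n. ?X (n + j)) \<longlonglongrightarrow> L"
    by (rule decseq_convergent[where B = 0]) auto
  then have "?X \<longlonglongrightarrow> L"
    by (rule LIMSEQ_offset)
  then show ?thesis
    by (rule convergentI)
qed

lemma Suc_times_binomial_Suc:
  assumes "j \<le> n"
  shows "real (Suc j) * real (n choose Suc j) = (real n - real j) * real (n choose j)"
proof -
  have "Suc j * (n choose Suc j) = (n - j) * (n choose j)"
    using binomial_absorb_comp[of n j] binomial_absorption[of j n] by simp
  then have "real (Suc j) * real (n choose Suc j) = real (n - j) * real (n choose j)"
    by (metis of_nat_mult)
  then show ?thesis using assms by (simp add: of_nat_diff)
qed

lemma turan_density_LIMSEQ:
  "(\<lambda>n. real (ex_number k n F) / real (n choose k)) \<longlonglongrightarrow> turan_density k F"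
  unfolding turan_density_def convergent_LIMSEQ_iff[symmetric]
  by (rule convergent_binomial_ratio) (rule ex_number_step)

text \<open>
  Averaging gives convergence of \<open>exco\<^sub>2\<close> divided by \<open>n choose (k + 1)\<close>. The normalisation of the density
  differs from this by the factor
  \<open>(n choose (k + 1)) / ((n choose (k - 1)) (n - k + 1)\<^sup>2) = (n - k) / ((n - k + 1) k (k + 1))\<close>, which
  converges.
\<close>

lemma codeg_sq_density_LIMSEQ:
  assumes "k \<ge> 1"
  shows "(\<lambda>n. real (exco2_number k n F) / (real (n choose (k - 1)) * (real n - real k + 1)\<^sup>2))
    \<longlonglongrightarrow> codeg_sq_density k F"
proof -
  obtain m where k: "k = Suc m"
    using assms by (cases k) auto
  let ?X = "\<lambda>n. real (exco2_number k n F) / real (n choose Suc k)"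
  let ?r = "\<lambda>n. (real n - k) / (real n - k + 1) / (real k * real (Suc k))"
  let ?Y = "\<lambda>n. real (exco2_number k n F) / (real (n choose (k - 1)) * (real n - real k + 1)\<^sup>2)"
  have "convergent ?X"
    by (rule convergent_binomial_ratio) (rule exco2_number_step[OF assms])
  then obtain L where "?X \<longlonglongrightarrow> L"
    unfolding convergent_def by (rule exE)
  moreover have "(\<lambda>n. (real n - k) / (real n - k + 1)) \<longlonglongrightarrow> 1"
    by real_asymp
  then have "?r \<longlonglongrightarrow> 1 / (real k * real (Suc k))"
    using assms by (intro tendsto_divide tendsto_const) auto
  ultimately have "(\<lambda>n. ?X n * ?r n) \<longlonglongrightarrow> L * (1 / (real k * real (Suc k)))"
    by (rule tendsto_mult)
  moreover have "\<forall>\<^sub>F n in sequentially. ?X n * ?r n = ?Y n"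
    using eventually_gt_at_top[of k]
  proof eventually_elim
    case (elim n)
    define A where "A = real (n choose m)"
    define B where "B = real (n choose Suc k)"
    define t where "t = real n - real k"
    have pos: "A > 0" "B > 0" "t > 0"
      using elim by (auto simp: A_def B_def t_def k simp del: binomial_Suc_Suc)
    have "real (Suc k) * B = t * real (n choose k)"
      using Suc_times_binomial_Suc[of k n] elim by (simp only: B_def t_def less_imp_le)
    moreover have "real k * real (n choose k) = (t + 1) * A"
      using Suc_times_binomial_Suc[of m n] elim by (simp add: A_def t_def k)
    ultimately have "real k * real (Suc k) * B = t * ((t + 1) * A)"
      by (metis mult.assoc mult.left_commute)
    then have eq: "real k * real (Suc k) = t * ((t + 1) * A) / B"
      using pos by (simp only: nonzero_eq_divide_eq)
    have "?X n * ?r n = real (exco2_number k n F) / B * (t / (t + 1) / (t * ((t + 1) * A) / B))"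
      unfolding eq by (simp add: B_def t_def)
    also have "\<dots> = real (exco2_number k n F) / (A * (t + 1)\<^sup>2)"
      using pos by (simp add: power2_eq_square)
    finally show ?case by (simp add: A_def t_def k)
  qed
  ultimately have Y: "?Y \<longlonglongrightarrow> L * (1 / (real k * real (Suc k)))"
    by (rule Lim_transform_eventually)
  show ?thesis
    unfolding codeg_sq_density_def limI[OF Y] by (rule Y)
qed

section \<open>Passage to the limit\<close>

lemma exco2_number_le:
  assumes "Suc m < n"
  shows "real (exco2_number (Suc m) n F)
    \<le> real n * (real (ex_number (Suc m) n F))\<^sup>2 / (n choose Suc m)
      + real m * (real n - real (Suc m)) * ex_number (Suc m) n F"
proof (cases "free_hypergraphs (Suc m) n F = {}")
  case True
  then show ?thesis by (simp add: exco2_number_def ex_number_def Sup_nat_def)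
next
  case False
  then obtain H where "H \<in> free_hypergraphs (Suc m) n F"
    and eq: "exco2_number (Suc m) n F = co2 (Suc m) H"
    using SUP_nat_attained[OF finite_free_hypergraphs] unfolding exco2_number_def by metis
  then have V: "card (verts H) = n" and H: "uniform_hypergraph (Suc m) H" "\<not> contains_copy H F"
    by (auto simp: free_hypergraphs_def)
  have e: "card (edges H) \<le> ex_number (Suc m) n F"
    using free_hypergraph_le_extremal(1)[OF H] V by simp
  have "real (co2 (Suc m) H) \<le> real n * (real (card (edges H)))\<^sup>2 / (n choose Suc m)
      + real m * (real n - real (Suc m)) * card (edges H)"
    using codegree_square_sum_le[OF H(1)] assms V by simp
  also have "\<dots> \<le> real n * (real (ex_number (Suc m) n F))\<^sup>2 / (n choose Suc m)
      + real m * (real n - real (Suc m)) * ex_number (Suc m) n F"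
    using e assms by (intro add_mono mult_left_mono divide_right_mono power_mono) auto
  finally show ?thesis by (simp add: eq)
qed

theorem theorem5p1:
  fixes F :: "'a hypergraph" and k :: nat
  assumes "k \<ge> 1"
    and "uniform_hypergraph k F"
    and "turan_density k F > 0"
  shows "codeg_sq_density k F
           \<le> turan_density k F * (turan_density k F / real k + 1 - 1 / real k)"
proof -
  obtain m where k: "k = Suc m"
    using assms(1) by (cases k) auto
  let ?p = "turan_density k F"
  define a where "a n = real (ex_number k n F) / real (n choose k)" for n
  \<comment> \<open>The bound on \<open>exco\<^sub>2\<close> after normalisation, in terms of the edge density \<open>a n\<close>.\<close>
  define U where "U n = (a n)\<^sup>2 * (real n / (real n - k + 1)) / k
      + a n * real m * ((real n - k) / (real n - k + 1)) / k" for n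
  have "a \<longlonglongrightarrow> ?p"
    unfolding a_def by (rule turan_density_LIMSEQ)
  moreover have "(\<lambda>n. real n / (real n - k + 1)) \<longlonglongrightarrow> 1"
    "(\<lambda>n. (real n - k) / (real n - k + 1)) \<longlonglongrightarrow> 1"
    by real_asymp+
  ultimately have U: "U \<longlonglongrightarrow> ?p\<^sup>2 * 1 / k + ?p * real m * 1 / k"
    unfolding U_def by (intro tendsto_intros) (auto simp: k)
  have le: "\<forall>\<^sub>F n in sequentially.
      real (exco2_number k n F) / (real (n choose (k - 1)) * (real n - real k + 1)\<^sup>2) \<le> U n"
    using eventually_gt_at_top[of k]
  proof eventually_elim
    case (elim n)
    define A where "A = real (n choose m)"
    define C where "C = real (n choose k)"
    define t where "t = real n - real k"
    have pos: "A > 0" "C > 0" "t > 0" "real k > 0"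
      using elim by (auto simp: A_def C_def t_def k simp del: binomial_Suc_Suc)
    have eq: "real k * C = (t + 1) * A"
      using Suc_times_binomial_Suc[of m n] elim by (simp add: A_def C_def t_def k)
    have ex: "real (ex_number k n F) = a n * C"
      using pos by (simp add: a_def C_def)
    have "real (exco2_number k n F) / (A * (t + 1)\<^sup>2)
        \<le> (real n * (a n * C)\<^sup>2 / C + real m * t * (a n * C)) / (A * (t + 1)\<^sup>2)"
      using exco2_number_le[of m n F] elim pos
      by (intro divide_right_mono) (simp_all add: k[symmetric] ex C_def[symmetric] t_def)
    also have "\<dots> = (real n * (a n * C)\<^sup>2 / C + real m * t * (a n * C)) / (real k * C * (t + 1))"
      unfolding eq by (simp only: power2_eq_square mult_ac)
    also have "\<dots> = U n"
      using pos by (simp add: U_def t_def[symmetric] divide_simps) (simp add: algebra_simps power2_eq_square)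
    finally show ?case by (simp add: A_def t_def k)
  qed
  have "codeg_sq_density k F \<le> ?p\<^sup>2 * 1 / k + ?p * real m * 1 / k"
    by (rule tendsto_le[OF sequentially_bot U codeg_sq_density_LIMSEQ[OF assms(1)] le])
  also have "\<dots> = ?p * (?p / real k + 1 - 1 / real k)"
    by (simp add: k field_simps power2_eq_square)
  finally show ?thesis .
qed

end
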